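(* Let $\mathcal{H}_N$ be an $N$-dimensional Hilbert space with orthonormal basis $\{e_i\}_{i=1}^N$, and let $W\subseteq\mathcal{H}_N$ be a subspace of dimension $k\ge 1$. (1) If $k\ge \frac{N}{2}$, there are (non-orthogonal) projections $\{\mathcal{P}_i\}_{i=1}^2$ onto $W$ such that $\mathcal{P}_1^*\mathcal{P}_1+\mathcal{P}_2^*\mathcal{P}_2=2I$. (2) If $N=kL$ with $L$ a positive integer, there are (non-orthogonal) projections $\{\mathcal{P}_i\}_{i=1}^L$ onto $W$ such that $\sum_{i=1}^L\mathcal{P}_i^*\mathcal{P}_i=LI$. (3) If $N=kL+M$ with $L$ a positive integer and $1\le M<k$, there exist a subspace $W$ of $\mathcal{H}_N$ of dimension $k$ and (non-orthogonal) projections $\{\mathcal{P}_i\}_{i=1}^{L+1}$ onto $W$ such that $\sum_{i=1}^{L+1}\mathcal{P}_i^*\mathcal{P}_i$ has $\{e_i\}_{i=1}^N$ as eigenvectors, with eigenvalue $L+1$ for $\{e_i\}_{i=1}^{N-M}$ and eigenvalue $L$ for $\{e_i\}_{i=N-M+1}^N$.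
   Context: A (non-orthogonal) projection onto a subspace $W$ of a Hilbert space $\mathcal{H}$ is a linear map $\mathcal{P}$ from $\mathcal{H}$ onto $W$ with $\mathcal{P}^2=\mathcal{P}$; it is not required to be self-adjoint (orthogonal projections are allowed as a special case). $\mathcal{P}^*$ is its adjoint and $I$ is the identity operator. In (3) the subspace $W$ is not given in advance but is part of what is asserted to exist. *)

theory Defs
  imports Complex_Main
begin

text \<open>
  The scalars of a Hilbert space are the real or the complex numbers. Both are covered by one type
  class: the two axioms on the conjugation leave no further models, see \<open>rclike_real_or_complex\<close>.
\<close>

class rclike = real_normed_field +
  fixes conjg :: "'a \<Rightarrow> 'a"
  assumes conjg_add: "conjg (x + y) = conjg x + conjg y"
    and mult_conjg_scaleR: "x * conjg x = (norm x)\<^sup>2 *\<^sub>R 1"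

instantiation real :: rclike
begin
definition conjg_real :: "real \<Rightarrow> real" where "conjg_real x = x"
instance by standard (simp_all add: conjg_real_def power2_eq_square)
end

instantiation complex :: rclike
begin
definition conjg_complex :: "complex \<Rightarrow> complex" where "conjg_complex = cnj"
instance
  by standard (simp_all only: conjg_complex_def complex_cnj_add complex_norm_square [symmetric] of_real_def [symmetric])
end

lemma mult_conjg: "x * conjg x = of_real ((norm (x :: 'a::rclike))\<^sup>2)"
  unfolding of_real_def by (rule mult_conjg_scaleR)

lemma conjg_of_real [simp]: "conjg (of_real r :: 'a::rclike) = of_real r"
proof (cases "r = 0")
  case True
  have "conjg (0 + 0 :: 'a) = conjg 0 + conjg 0" by (rule conjg_add)
  then show ?thesis using True by simp
next
  case False
  have "of_real r * conjg (of_real r :: 'a) = of_real r * of_real r"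
    by (simp add: mult_conjg power2_eq_square)
  then show ?thesis using False by simp
qed

lemma conjg_0 [simp]: "conjg (0 :: 'a::rclike) = 0"
  and conjg_1 [simp]: "conjg (1 :: 'a::rclike) = 1"
  using conjg_of_real [of 0] conjg_of_real [of 1] by simp_all

lemma conjg_minus: "conjg (- x) = - conjg (x :: 'a::rclike)"
proof -
  have "conjg (x + - x) = conjg x + conjg (- x)" by (rule conjg_add)
  then show ?thesis by (simp add: eq_neg_iff_add_eq_0 add.commute)
qed

lemma conjg_mult: "conjg (x * y) = conjg x * conjg (y :: 'a::rclike)"
proof (cases "x * y = 0")
  case False
  have "(x * y) * conjg (x * y) = (x * conjg x) * (y * conjg y)"
    by (simp add: mult_conjg norm_mult power_mult_distrib)
  also have "\<dots> = (x * y) * (conjg x * conjg y)" by (simp add: ac_simps)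
  finally show ?thesis using False by simp
qed auto

lemma add_conjg_Reals: "x + conjg (x :: 'a::rclike) \<in> \<real>"
proof -
  have "(x + 1) * conjg (x + 1) = x * conjg x + (x + conjg x) + 1"
    by (simp add: conjg_add algebra_simps)
  then have "x + conjg x = of_real ((norm (x + 1))\<^sup>2 - (norm x)\<^sup>2 - 1)"
    by (simp add: mult_conjg algebra_simps)
  then show ?thesis by (metis Reals_of_real)
qed

lemma conjg_conjg [simp]: "conjg (conjg x) = (x :: 'a::rclike)"
proof -
  obtain r where r: "x + conjg x = of_real r" using add_conjg_Reals by (metis Reals_cases)
  have "conjg x + conjg (conjg x) = conjg (x + conjg x)" by (simp add: conjg_add)
  also have "\<dots> = x + conjg x" by (simp add: r)
  finally show ?thesis by simp
qed

lemma rclike_real_or_complex: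
  "(\<forall>x :: 'a::rclike. \<exists>a. x = of_real a) \<or>
   (\<exists>u :: 'a. u * u = - 1 \<and> conjg u = - u \<and> (\<forall>x. \<exists>a b. x = of_real a + of_real b * u))"
proof (cases "\<forall>x :: 'a. \<exists>a. x = of_real a")
  case False
  then obtain x :: 'a where x: "\<And>a. x \<noteq> of_real a" by blast
  have split: "\<exists>a w. z = of_real a + w \<and> conjg w = - w" for z :: 'a
  proof -
    obtain r where r: "z + conjg z = of_real r" using add_conjg_Reals by (metis Reals_cases)
    then have cz: "conjg z = of_real r - z" by (metis add_diff_cancel_left')
    have half: "(of_real r :: 'a) = of_real (r / 2) + of_real (r / 2)"
      by (metis of_real_add field_sum_of_halves)
    have "conjg (z + - of_real (r / 2)) = of_real r - z + - of_real (r / 2)"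
      by (simp only: conjg_add conjg_minus conjg_of_real cz)
    then have "conjg (z + - of_real (r / 2)) = - (z + - of_real (r / 2))"
      unfolding half by simp
    moreover have "z = of_real (r / 2) + (z + - of_real (r / 2))" by simp
    ultimately show ?thesis by blast
  qed
  obtain a w where w: "x = of_real a + w" "conjg w = - w" using split by blast
  have w0: "w \<noteq> 0" using w(1) x [of a] by auto
  define u where "u = of_real (1 / norm w) * w"
  have cu: "conjg u = - u" by (simp add: u_def conjg_mult w(2) del: of_real_divide)
  have "norm u = 1" using w0 by (simp add: u_def norm_mult norm_divide)
  then have "u * conjg u = 1" by (simp only: mult_conjg) simp
  then have uu: "u * u = - 1" by (simp add: cu minus_equation_iff)
  have "\<exists>a b. z = of_real a + of_real b * u" for z
  proof -
    obtain c v where v: "z = of_real c + v" "conjg v = - v" using split by blast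
    obtain r where r: "v * u + conjg (v * u) = of_real r"
      using add_conjg_Reals by (metis Reals_cases)
    have "2 * (v * u) = of_real r"
      using r by (simp only: conjg_mult v(2) cu minus_mult_minus mult_2)
    then have "v * u = of_real (r / 2)" by (simp add: eq_divide_eq mult.commute [of _ 2])
    then have "v * (u * u) = of_real (r / 2) * u" by (simp only: mult.assoc [symmetric])
    then have "v = - (of_real (r / 2) * u)"
      unfolding uu by (simp only: mult_minus_right mult_1_right minus_equation_iff [of v])
    then have "v = of_real (- (r / 2)) * u" by (simp only: of_real_minus mult_minus_left)
    then show ?thesis using v(1) by blast
  qed
  then show ?thesis using uu cu by blast
qed blast

text \<open>
  In the finite-dimensional situation considered here completeness is automatic, so that the Hilbert
  spaces are exactly the inner product spaces.
\<close>

locale inner_product_space = vector_space scale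
  for scale :: "'k::rclike \<Rightarrow> 'v::ab_group_add \<Rightarrow> 'v" (infixr \<open>*s\<close> 75) +
  fixes ip :: "'v \<Rightarrow> 'v \<Rightarrow> 'k"
  assumes ip_add_left: "ip (x + y) z = ip x z + ip y z"
    and ip_scale_left: "ip (a *s x) y = a * ip x y"
    and ip_conjg: "ip y x = conjg (ip x y)"
    and ip_pos: "x \<noteq> 0 \<Longrightarrow> \<exists>r>0. ip x x = of_real r"

definition orthonormal_basis ::
    "('k::rclike \<Rightarrow> 'v::ab_group_add \<Rightarrow> 'v) \<Rightarrow> ('v \<Rightarrow> 'v \<Rightarrow> 'k) \<Rightarrow> nat \<Rightarrow> (nat \<Rightarrow> 'v) \<Rightarrow> bool" where
  "orthonormal_basis scale ip N e \<longleftrightarrow>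
     (\<forall>i\<in>{1..N}. \<forall>j\<in>{1..N}. ip (e i) (e j) = (if i = j then 1 else 0)) \<and>
     module.span scale (e ` {1..N}) = UNIV"

definition projection_onto ::
    "('k::rclike \<Rightarrow> 'v::ab_group_add \<Rightarrow> 'v) \<Rightarrow> 'v set \<Rightarrow> ('v \<Rightarrow> 'v) \<Rightarrow> bool" where
  "projection_onto scale W P \<longleftrightarrow> Vector_Spaces.linear scale scale P \<and> range P = W \<and> P \<circ> P = P"

text \<open>
  As for the library's \<open>adjoint\<close> on real inner product spaces, the choice is harmless: the adjoint of a
  linear map exists (\<open>ip_adjoint_works\<close>) and is unique (\<open>ip_adjoint_unique\<close>).
\<close>

definition ip_adjoint :: "('v \<Rightarrow> 'v \<Rightarrow> 'k) \<Rightarrow> ('v \<Rightarrow> 'v) \<Rightarrow> 'v \<Rightarrow> 'v" where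
  "ip_adjoint ip f = (SOME g. \<forall>x y. ip (f x) y = ip x (g y))"

definition eigenvector_of ::
    "('k::rclike \<Rightarrow> 'v::ab_group_add \<Rightarrow> 'v) \<Rightarrow> ('v \<Rightarrow> 'v) \<Rightarrow> 'k \<Rightarrow> 'v \<Rightarrow> bool" where
  "eigenvector_of scale T c x \<longleftrightarrow> x \<noteq> 0 \<and> T x = scale c x"

context inner_product_space
begin

lemma ip_0_left [simp]: "ip 0 y = 0"
  using ip_scale_left [of 0 0 y] by simp

lemma ip_add_right: "ip x (y + z) = ip x y + ip x z"
  by (metis ip_add_left ip_conjg conjg_add)

lemma ip_scale_right: "ip x (a *s y) = conjg a * ip x y"
  by (metis ip_scale_left ip_conjg conjg_mult)

lemma ip_0_right [simp]: "ip y 0 = 0"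
  by (metis ip_0_left ip_conjg conjg_0)

lemma ip_sum_left: "ip (sum f A) y = (\<Sum>i\<in>A. ip (f i) y)"
  by (induction A rule: infinite_finite_induct) (simp_all add: ip_add_left)

lemma ip_sum_right: "ip y (sum f A) = (\<Sum>i\<in>A. ip y (f i))"
  by (induction A rule: infinite_finite_induct) (simp_all add: ip_add_right)

lemma ip_eq_0: "ip x x = 0 \<Longrightarrow> x = 0"
  using ip_pos by fastforce

lemma ip_left_cancel:
  assumes "\<And>x. ip x y = ip x z" shows "y = z"
proof -
  have "ip (y - z) y = ip (y - z) ((y - z) + z) " by simp
  then have "ip (y - z) (y - z) = 0"
    using assms [of "y - z"] by (simp only: ip_add_right) simp
  then show ?thesis using ip_eq_0 by fastforce
qed

lemma orthonormal_basis_expansion: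
  assumes "orthonormal_basis scale ip N e"
  shows "x = (\<Sum>i\<in>{1..N}. ip x (e i) *s e i)"
proof -
  have on: "ip (e i) (e j) = (if i = j then 1 else 0)" if "i \<in> {1..N}" "j \<in> {1..N}" for i j
    using assms that unfolding orthonormal_basis_def by blast
  have "x \<in> span (e ` {1..N})"
    using assms unfolding orthonormal_basis_def by simp
  then show ?thesis
  proof (induction rule: span_induct_alt)
    case base
    then show ?case by simp
  next
    case (step c b y)
    then obtain j where j: "j \<in> {1..N}" "b = e j" by blast
    have "(\<Sum>i\<in>{1..N}. ip b (e i) *s e i) = (\<Sum>i\<in>{1..N}. if i = j then e j else 0)"
      using j by (intro sum.cong) (auto simp: on)
    also have "\<dots> = b" using j by (simp add: sum.delta)
    finally have "(\<Sum>i\<in>{1..N}. ip b (e i) *s e i) = b" .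
    then have "(\<Sum>i\<in>{1..N}. ip (c *s b + y) (e i) *s e i)
        = c *s b + (\<Sum>i\<in>{1..N}. ip y (e i) *s e i)"
      by (simp add: ip_add_left ip_scale_left scale_left_distrib sum.distrib
          scale_scale [symmetric] scale_sum_right [symmetric] del: scale_scale)
    then show ?case using step by simp
  qed
qed

lemma ip_adjoint_works:
  assumes "orthonormal_basis scale ip N e" and "Vector_Spaces.linear scale scale f"
  shows "ip (f x) y = ip x (ip_adjoint ip f y)"
proof -
  interpret f: Vector_Spaces.linear scale scale f by fact
  define g where "g y = (\<Sum>i\<in>{1..N}. ip y (f (e i)) *s e i)" for y
  have "ip (f x) y = ip x (g y)" for x y
  proof -
    have "ip (f x) y = ip (f (\<Sum>i\<in>{1..N}. ip x (e i) *s e i)) y"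
      using orthonormal_basis_expansion [OF assms(1), of x] by simp
    also have "\<dots> = (\<Sum>i\<in>{1..N}. ip x (e i) * ip (f (e i)) y)"
      by (simp add: f.sum f.scale ip_sum_left ip_scale_left)
    also have "\<dots> = ip x (g y)"
      unfolding g_def ip_sum_right ip_scale_right
      by (intro sum.cong refl) (metis ip_conjg mult.commute)
    finally show ?thesis .
  qed
  then have "\<exists>g. \<forall>x y. ip (f x) y = ip x (g y)" by blast
  then show ?thesis
    unfolding ip_adjoint_def by (rule someI2_ex) simp
qed

lemma ip_adjoint_unique:
  assumes "\<And>x y. ip (f x) y = ip x (g y)"
  shows "ip_adjoint ip f = g"
proof -
  have "\<forall>x y. ip (f x) y = ip x (ip_adjoint ip f y)"
    unfolding ip_adjoint_def by (rule someI [of _ g]) (simp add: assms)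
  then show ?thesis by (intro ext ip_left_cancel) (metis assms)
qed

end

end

theory Submission
  imports Defs
begin

text \<open>
  Let \<open>b\<^sub>1, \<dots>, b\<^sub>N\<close> be an orthonormal basis whose first \<open>k\<close> members span the target \<open>V\<close>. A projection
  onto \<open>V\<close> fixes these members and may send the others anywhere in \<open>V\<close>. Suppose \<open>N \<le> k * R\<close>, and
  arrange the basis in consecutive blocks of length \<open>k\<close>, the last one possibly incomplete, so that
  there are at most \<open>R\<close> of them. Given an \<open>R \<times> R\<close> matrix \<open>c\<close>, let the \<open>m\<close>-th projection send the
  vector at position \<open>p\<close> of block \<open>a\<close> to \<open>c\<^sub>m\<^sub>a b\<^sub>p\<close>. It is a projection as soon as the first column of
  \<open>c\<close> is constantly \<open>1\<close>. The matrix of \<open>\<Sum>\<^sub>m P\<^sub>m\<^sup>* P\<^sub>m\<close> has the entries \<open>\<Sum>\<^sub>m \<langle>P\<^sub>m b\<^sub>j, P\<^sub>m b\<^sub>i\<rangle>\<close>. These vanish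
  for vectors at different positions, since \<open>b\<^sub>1, \<dots>, b\<^sub>k\<close> are orthonormal, and for vectors in different
  blocks if the columns of \<open>c\<close> are orthogonal. With columns of squared norm \<open>R\<close> the sum is therefore
  \<open>R I\<close>; rescaling the image of a vector \<open>b\<^sub>j\<close> outside \<open>V\<close> by a real \<open>t\<^sub>j\<close> turns its diagonal entry
  into \<open>R t\<^sub>j\<^sup>2\<close> (\<open>projections_with_diagonal_sum\<close>).

  Over the complex numbers the Fourier matrix would serve as \<open>c\<close>, but a real matrix covers both
  scalar fields: a Householder reflection that maps the first unit vector to a multiple of the
  all-ones vector, scaled by \<open>\<surd>R\<close> and with the sign that makes its first column \<open>1\<close>
  (\<open>householder_first_column\<close>, \<open>householder_columns_orthogonal\<close>).

  For a prescribed subspace \<open>W\<close>, a basis adapted to \<open>W\<close> comes from two rounds of Gram--Schmidt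
  (\<open>adapted_orthonormal_basis\<close>); the first claim is then \<open>R = 2\<close> and the second \<open>R = L\<close>. For the third take
  the given basis itself, \<open>V\<close> the span of its first \<open>k\<close> members, \<open>R = L + 1\<close>, and
  \<open>t\<^sub>j = \<surd>(L / (L + 1))\<close> on the incomplete last block.
\<close>

section \<open>A real matrix with orthogonal columns and constant first column\<close>

text \<open>
  Up to sign this is \<open>s = \<surd>R\<close> times the reflection \<open>I - 2 u u\<^sup>T / (u\<^sup>T u)\<close>, where \<open>u\<close> is the all-ones
  vector plus \<open>s\<close> times the first unit vector and \<open>u\<^sup>T u = 2 s (s + 1)\<close>. Adding the unit vector rather
  than subtracting it keeps \<open>u\<close> nonzero also for \<open>R = 1\<close>. Indices start at \<open>1\<close>.
\<close>

definition householder :: "nat \<Rightarrow> nat \<Rightarrow> nat \<Rightarrow> real" where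
  "householder R m a =
     (let s = sqrt R; u = (\<lambda>m. 1 + (if m = 1 then s else 0))
      in u m * u a / (s + 1) - (if m = a then s else 0))"

lemma householder_first_column: "householder R m 1 = 1"
proof -
  have "sqrt R + 1 \<noteq> 0" using real_sqrt_ge_zero [of R] by linarith
  then show ?thesis by (simp add: householder_def Let_def add.commute)
qed

text \<open>
  Expanding the product of two columns leaves \<open>u\<^sub>a u\<^sub>b\<close> times \<open>u\<^sup>T u / (s + 1)\<^sup>2 - 2 s / (s + 1)\<close>, which is
  zero by the value of \<open>u\<^sup>T u\<close>, and \<open>s\<^sup>2\<close> times a Kronecker delta.
\<close>

lemma householder_columns_orthogonal:
  assumes a: "a \<in> {1..R}" and b: "b \<in> {1..R}"
  shows "(\<Sum>m=1..R. householder R m a * householder R m b) = (if a = b then real R else 0)"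
proof -
  define s where "s = sqrt R"
  define u where "u m = 1 + (if m = 1 then s else 0)" for m :: nat
  define d where "d x y = (if x = y then 1 else (0::real))" for x y :: nat
  have s2: "s * s = R" and s0: "s \<ge> 0" by (simp_all add: s_def)
  have R: "1 \<in> {1..R}" using a by auto
  have pick: "(\<Sum>m=1..R. f m * d m x) = f x" if "x \<in> {1..R}" for f x
  proof -
    have "(\<Sum>m=1..R. f m * d m x) = (\<Sum>m=1..R. if m = x then f m else 0)"
      by (intro sum.cong) (auto simp: d_def)
    then show ?thesis using that by simp
  qed
  have c: "householder R m x = u m * u x / (s + 1) - s * d m x" for m x
    by (simp add: householder_def Let_def u_def s_def d_def)
  have u: "u m = 1 + s * d m 1" for m by (simp add: u_def d_def)
  have "(\<Sum>m=1..R. u m * u m) = (\<Sum>m=1..R. u m) + s * (\<Sum>m=1..R. u m * d m 1)"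
    unfolding sum_distrib_left sum.distrib [symmetric]
    by (intro sum.cong refl) (simp add: u algebra_simps)
  also have "(\<Sum>m=1..R. u m) = R + s * (\<Sum>m=1..R. 1 * d m 1)"
    by (simp add: u sum.distrib sum_distrib_left)
  also have "(\<Sum>m=1..R. 1 * d m 1) = 1" by (rule pick [OF R])
  also have "(\<Sum>m=1..R. u m * d m 1) = 1 + s" by (subst pick [OF R]) (simp add: u_def)
  finally have uu: "(\<Sum>m=1..R. u m * u m) = 2 * s * (s + 1)"
    by (simp add: s2 [symmetric] algebra_simps)
  have "(\<Sum>m=1..R. householder R m a * householder R m b)
      = u a * u b / (s + 1)\<^sup>2 * (\<Sum>m=1..R. u m * u m)
        - s * u a / (s + 1) * (\<Sum>m=1..R. u m * d m b)
        - s * u b / (s + 1) * (\<Sum>m=1..R. u m * d m a)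
        + s * s * (\<Sum>m=1..R. d m a * d m b)"
    unfolding sum_distrib_left sum.distrib [symmetric] sum_subtractf [symmetric]
    by (intro sum.cong refl) (simp add: c algebra_simps power2_eq_square)
  also have "\<dots> = u a * u b / (s + 1)\<^sup>2 * (2 * s * (s + 1))
        - s * u a / (s + 1) * u b - s * u b / (s + 1) * u a + R * d a b"
    unfolding uu pick [OF a] pick [OF b] s2 by (simp add: d_def)
  also have "\<dots> = R * d a b"
    using s0 by (simp add: power2_eq_square)
  finally show ?thesis by (simp add: d_def)
qed

section \<open>Orthonormal bases adapted to a subspace\<close>

context inner_product_space
begin

definition orthonormal :: "nat \<Rightarrow> (nat \<Rightarrow> 'v) \<Rightarrow> bool" where
  "orthonormal n b \<longleftrightarrow> (\<forall>i\<in>{1..n}. \<forall>j\<in>{1..n}. ip (b i) (b j) = (if i = j then 1 else 0))"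

lemma orthonormal_basis_iff:
  "orthonormal_basis scale ip n b \<longleftrightarrow> orthonormal n b \<and> span (b ` {1..n}) = UNIV"
  by (simp add: orthonormal_basis_def orthonormal_def)

lemma orthonormal_inj_on: "orthonormal n b \<Longrightarrow> inj_on b {1..n}"
  unfolding orthonormal_def inj_on_def by (metis zero_neq_one)

lemma orthonormal_independent:
  assumes "orthonormal n b" shows "independent (b ` {1..n})"
proof -
  have "g (b j) = 0" if g: "(\<Sum>i\<in>{1..n}. g (b i) *s b i) = 0" and j: "j \<in> {1..n}" for g j
  proof -
    have "0 = (\<Sum>i\<in>{1..n}. g (b i) * ip (b i) (b j))"
      using arg_cong [OF g, of "\<lambda>x. ip x (b j)"] by (simp add: ip_sum_left ip_scale_left)
    also have "\<dots> = (\<Sum>i\<in>{1..n}. if i = j then g (b j) else 0)"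
      using assms j by (intro sum.cong) (auto simp: orthonormal_def)
    also have "\<dots> = g (b j)" using j by simp
    finally show ?thesis by simp
  qed
  then show ?thesis
    by (intro independent_if_scalars_zero)
       (auto simp: sum.reindex [OF orthonormal_inj_on [OF assms]] simp del: One_nat_def)
qed

lemma dim_span_orthonormal:
  assumes "orthonormal n b" shows "dim (span (b ` {1..n})) = n"
  by (simp add: dim_span dim_eq_card_independent [OF orthonormal_independent [OF assms]]
      card_image [OF orthonormal_inj_on [OF assms]] del: One_nat_def)

text \<open>The Gram--Schmidt step: subtract from \<open>x\<close> its orthogonal projection and normalise.\<close>

lemma unit_vector_orthogonal_to_orthonormal:
  assumes b: "orthonormal n b" and S: "subspace S" "b ` {1..n} \<subseteq> S"
    and x: "x \<in> S" "x \<notin> span (b ` {1..n})"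
  obtains y where "y \<in> S" "ip y y = 1" "\<And>i. i \<in> {1..n} \<Longrightarrow> ip y (b i) = 0"
proof -
  define p where "p = (\<Sum>i\<in>{1..n}. ip x (b i) *s b i)"
  have p_span: "p \<in> span (b ` {1..n})"
    unfolding p_def by (intro span_sum span_scale span_base) auto
  then have p_S: "p \<in> S" using span_minimal [OF S(2,1)] by blast
  have "x - p \<noteq> 0" using p_span x(2) by auto
  then obtain r where r: "r > 0" "ip (x - p) (x - p) = of_real r" using ip_pos by blast
  define y where "y = of_real (1 / sqrt r) *s (x - p)"
  have "y \<in> S" unfolding y_def by (intro subspace_scale subspace_diff S x p_S)
  moreover have "ip y y = of_real (1 / sqrt r) * of_real (1 / sqrt r) * of_real r"
    by (simp only: y_def ip_scale_left ip_scale_right r conjg_of_real mult.assoc)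
  then have "ip y y = of_real (1 / sqrt r * (1 / sqrt r) * r)" by (simp only: of_real_mult)
  then have "ip y y = 1" using r(1) by simp
  moreover have "ip y (b i) = 0" if i: "i \<in> {1..n}" for i
  proof -
    have "ip p (b i) = (\<Sum>j\<in>{1..n}. if j = i then ip x (b i) else 0)"
      unfolding p_def ip_sum_left using b i
      by (intro sum.cong) (auto simp: ip_scale_left orthonormal_def)
    then have "ip p (b i) = ip x (b i)" using i by simp
    moreover have "ip (x - p) (b i) + ip p (b i) = ip x (b i)"
      by (metis ip_add_left diff_add_cancel)
    ultimately show ?thesis by (simp add: y_def ip_scale_left)
  qed
  ultimately show ?thesis by (rule that)
qed

text \<open>
  The members already present are kept, so that a basis of a subspace can be prolonged to one of the
  whole space. Each Gram--Schmidt step lowers \<open>dim S - n\<close>, which cannot become negative because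
  orthonormal families are independent.
\<close>

lemma orthonormal_extend:
  assumes e: "orthonormal_basis scale ip N e" and S: "subspace S"
    and b: "orthonormal n b" "b ` {1..n} \<subseteq> S"
  obtains b' where "\<And>i. i \<in> {1..n} \<Longrightarrow> b' i = b i"
    "orthonormal (dim S) b'" "span (b' ` {1..dim S}) = S"
proof -
  interpret finite_dimensional_vector_space scale "e ` {1..N}"
    using e by unfold_locales (auto simp: orthonormal_basis_iff orthonormal_independent simp del: One_nat_def)
  have "\<exists>b'. (\<forall>i\<in>{1..n}. b' i = b i) \<and> orthonormal (dim S) b' \<and> span (b' ` {1..dim S}) = S"
    using b
  proof (induction "dim S - n" arbitrary: n b rule: less_induct)
    case less
    have sub: "span (b ` {1..n}) \<subseteq> S" by (rule span_minimal [OF less.prems(2) S])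
    then have le: "n \<le> dim S"
      using dim_subset [OF sub] dim_span_orthonormal [OF less.prems(1)] by simp
    show ?case
    proof (cases "span (b ` {1..n}) = S")
      case True
      then have "dim S = n" using dim_span_orthonormal [OF less.prems(1)] by simp
      then show ?thesis using True less.prems by blast
    next
      case False
      then have lt: "n < dim S"
        using subspace_dim_equal [OF subspace_span S sub] le
          dim_span_orthonormal [OF less.prems(1)] by linarith
      obtain x where "x \<in> S" "x \<notin> span (b ` {1..n})" using False sub by blast
      then obtain y where y: "y \<in> S" "ip y y = 1" "\<And>i. i \<in> {1..n} \<Longrightarrow> ip y (b i) = 0"
        using unit_vector_orthogonal_to_orthonormal [OF less.prems(1) S less.prems(2)] by metis
      have y': "ip (b i) y = 0" if "i \<in> {1..n}" for i
        using y(3) [OF that] ip_conjg [of "b i" y] by simp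
      have "orthonormal (Suc n) (b(Suc n := y))"
        using less.prems(1) y y' by (auto simp: orthonormal_def le_Suc_eq)
      moreover have "(b(Suc n := y)) ` {1..Suc n} \<subseteq> S"
        using less.prems(2) y(1) by (auto simp: le_Suc_eq)
      ultimately obtain b' where b': "\<forall>i\<in>{1..Suc n}. b' i = (b(Suc n := y)) i"
          "orthonormal (dim S) b'" "span (b' ` {1..dim S}) = S"
        using less.hyps [of "Suc n" "b(Suc n := y)"] lt by (meson diff_less_mono2 lessI)
      then have "\<forall>i\<in>{1..n}. b' i = b i" by auto
      then show ?thesis using b' by blast
    qed
  qed
  then show ?thesis using that by blast
qed

lemma adapted_orthonormal_basis:
  assumes e: "orthonormal_basis scale ip N e" and W: "subspace W"
  obtains b where "orthonormal_basis scale ip N b" "span (b ` {1..dim W}) = W" "dim W \<le> N"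
proof -
  interpret finite_dimensional_vector_space scale "e ` {1..N}"
    using e by unfold_locales (auto simp: orthonormal_basis_iff orthonormal_independent simp del: One_nat_def)
  have N: "dim (UNIV :: 'v set) = N"
    using e dim_span_orthonormal [of N e] by (simp add: orthonormal_basis_iff)
  \<comment> \<open>first a basis of \<open>W\<close>, built from the empty family, then its extension to the whole space\<close>
  obtain a where a: "orthonormal (dim W) a" "span (a ` {1..dim W}) = W"
    by (rule orthonormal_extend [OF e W, of 0 e]) (auto simp: orthonormal_def)
  obtain b where b: "\<And>i. i \<in> {1..dim W} \<Longrightarrow> b i = a i" "orthonormal N b" "span (b ` {1..N}) = UNIV"
    using orthonormal_extend [OF e subspace_UNIV a(1)] N by auto
  have "b ` {1..dim W} = a ` {1..dim W}" using b(1) by (intro image_cong) auto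
  then show ?thesis
    using that [of b] a b dim_subset [of W UNIV] N by (simp add: orthonormal_basis_iff)
qed

section \<open>Projections from a matrix with orthogonal columns\<close>

text \<open>
  The central construction. The hypothesis \<open>N \<le> k * R\<close> says that the blocks can be matched with
  different columns of the matrix, and \<open>t = 1\<close> on the first block makes the maps fix its span.
\<close>

lemma projections_with_diagonal_sum:
  fixes t :: "nat \<Rightarrow> real"
  assumes b: "orthonormal_basis scale ip N b" and k: "1 \<le> k" "k \<le> N" and R: "N \<le> k * R"
    and t: "\<And>j. j \<in> {1..k} \<Longrightarrow> t j = 1"
  obtains P :: "nat \<Rightarrow> 'v \<Rightarrow> 'v" where
    "\<And>m. projection_onto scale (span (b ` {1..k})) (P m)"
    "\<And>x. (\<Sum>m=1..R. ip_adjoint ip (P m) (P m x))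
       = (\<Sum>j\<in>{1..N}. (of_real (real R * (t j)\<^sup>2) * ip x (b j)) *s b j)"
proof -
  define pos blk where "pos j = (j - 1) mod k + 1" and "blk j = (j - 1) div k + 1" for j
  have pos: "pos j \<in> {1..k}" for j
    using k mod_less_divisor [of k "j - 1"] by (auto simp: pos_def Suc_le_eq)
  have blk: "blk j \<in> {1..R}" if "j \<in> {1..N}" for j
  proof -
    have "j - 1 < R * k" using that R by (auto simp: mult.commute)
    then show ?thesis by (auto simp: blk_def Suc_le_eq less_mult_imp_div_less)
  qed
  have pos_blk: "i = j" if "i \<in> {1..N}" "j \<in> {1..N}" "pos i = pos j" "blk i = blk j" for i j
  proof -
    have "i - 1 = j - 1" using that(3,4) unfolding pos_def blk_def
      by (metis add_right_cancel div_mult_mod_eq)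
    then show ?thesis using that(1,2) by auto
  qed
  have on: "ip (b i) (b j) = (if i = j then 1 else 0)" if "i \<in> {1..N}" "j \<in> {1..N}" for i j
    using b that by (auto simp: orthonormal_basis_def)
  \<comment> \<open>the factor of the image of \<open>b j\<close> under the \<open>m\<close>-th projection; it is real, so that conjugation fixes it\<close>
  define c :: "nat \<Rightarrow> nat \<Rightarrow> 'k" where "c m j = of_real (t j * householder R m (blk j))" for m j
  define P where "P m x = (\<Sum>j\<in>{1..N}. (ip x (b j) * c m j) *s b (pos j))" for m x
  have lin: "Vector_Spaces.linear scale scale (P m)" for m
  proof unfold_locales
    show "P m (x + y) = P m x + P m y" for x y
      by (simp add: P_def ip_add_left distrib_right scale_left_distrib sum.distrib)
    show "P m (a *s x) = a *s P m x" for a x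
      by (simp add: P_def ip_scale_left scale_sum_right mult.assoc)
  qed
  have in_span: "P m x \<in> span (b ` {1..k})" for m x
    unfolding P_def using pos by (intro span_sum span_scale span_base) auto
  have P_b: "P m (b j) = c m j *s b (pos j)" if j: "j \<in> {1..N}" for m j
  proof -
    have "P m (b j) = (\<Sum>i\<in>{1..N}. if i = j then c m j *s b (pos j) else 0)"
      unfolding P_def using j by (intro sum.cong) (auto simp: on)
    then show ?thesis using j by simp
  qed
  have fix_b: "P m (b j) = b j" if j: "j \<in> {1..k}" for m j
  proof -
    have "blk j = 1" "pos j = j" using j by (auto simp: blk_def pos_def)
    then have "c m j = 1" using t [OF j] by (simp only: c_def householder_first_column) simp
    then show ?thesis using P_b [of j m] j k \<open>pos j = j\<close> by auto
  qed
  have fix_span: "P m x = x" if "x \<in> span (b ` {1..k})" for m x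
  proof -
    interpret P: Vector_Spaces.linear scale scale "P m" by (rule lin)
    show ?thesis
      using that by (induction rule: span_induct_alt) (auto simp: P.zero P.add P.scale fix_b)
  qed
  have "projection_onto scale (span (b ` {1..k})) (P m)" for m
  proof -
    have "range (P m) = span (b ` {1..k})"
      using in_span fix_span by (metis image_subset_iff rangeI subsetI subset_antisym)
    then show ?thesis
      unfolding projection_onto_def using lin in_span fix_span by (simp add: fun_eq_iff)
  qed
  moreover have "(\<Sum>m=1..R. ip_adjoint ip (P m) (P m x))
       = (\<Sum>j\<in>{1..N}. (of_real (real R * (t j)\<^sup>2) * ip x (b j)) *s b j)" for x
  proof (rule ip_left_cancel)
    fix y
    have "ip y (\<Sum>m=1..R. ip_adjoint ip (P m) (P m x)) = (\<Sum>m=1..R. ip (P m y) (P m x))"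
      by (simp only: ip_sum_right ip_adjoint_works [OF b lin])
    also have "\<dots> = (\<Sum>m=1..R. \<Sum>i\<in>{1..N}. \<Sum>j\<in>{1..N}.
        ip y (b j) * conjg (ip x (b i)) * ip (b (pos j)) (b (pos i)) * (c m j * c m i))"
      by (simp add: P_def ip_sum_left ip_sum_right ip_scale_left ip_scale_right conjg_mult
          sum_distrib_left c_def mult_ac del: of_real_mult)
    also have "\<dots> = (\<Sum>i\<in>{1..N}. \<Sum>j\<in>{1..N}. \<Sum>m=1..R.
        ip y (b j) * conjg (ip x (b i)) * ip (b (pos j)) (b (pos i)) * (c m j * c m i))"
      by (subst sum.swap) (intro sum.cong refl sum.swap)
    also have "\<dots> = (\<Sum>i\<in>{1..N}. \<Sum>j\<in>{1..N}.
        if j = i then ip y (b i) * conjg (ip x (b i)) * of_real (real R * (t i)\<^sup>2) else 0)"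
    proof (intro sum.cong refl)
      fix i j assume ji: "j \<in> {1..N}" "i \<in> {1..N}"
      have "(\<Sum>m=1..R. c m j * c m i)
          = of_real (t j * t i * (\<Sum>m=1..R. householder R m (blk j) * householder R m (blk i)))"
        by (simp add: c_def sum_distrib_left mult_ac)
      also have "\<dots> = of_real (t j * t i * (if blk j = blk i then real R else 0))"
        by (simp only: householder_columns_orthogonal [OF blk [OF ji(1)] blk [OF ji(2)]])
      finally have cc: "(\<Sum>m=1..R. c m j * c m i)
          = of_real (t j * t i * (if blk j = blk i then real R else 0))" .
      have "pos j \<in> {1..N}" "pos i \<in> {1..N}" using pos [of i] pos [of j] k by auto
      then have pp: "ip (b (pos j)) (b (pos i)) = (if pos j = pos i then 1 else 0)" by (rule on)
      \<comment> \<open>for \<open>i \<noteq> j\<close> the positions differ, or else the blocks do\<close>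
      show "(\<Sum>m=1..R. ip y (b j) * conjg (ip x (b i)) * ip (b (pos j)) (b (pos i)) * (c m j * c m i))
          = (if j = i then ip y (b i) * conjg (ip x (b i)) * of_real (real R * (t i)\<^sup>2) else 0)"
        unfolding sum_distrib_left [symmetric] cc pp
        using pos_blk [OF ji] by (auto simp: power2_eq_square mult_ac)
    qed
    also have "\<dots> = ip y (\<Sum>j\<in>{1..N}. (of_real (real R * (t j)\<^sup>2) * ip x (b j)) *s b j)"
      by (simp add: ip_sum_right ip_scale_right conjg_mult mult_ac del: of_real_mult)
    finally show "ip y (\<Sum>m=1..R. ip_adjoint ip (P m) (P m x))
       = ip y (\<Sum>j\<in>{1..N}. (of_real (real R * (t j)\<^sup>2) * ip x (b j)) *s b j)" .
  qed
  ultimately show ?thesis by (rule that)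
qed

lemma projections_sum_scalar:
  assumes e: "orthonormal_basis scale ip N e" and W: "subspace W" "dim W \<ge> 1"
    and R: "N \<le> dim W * R"
  obtains P :: "nat \<Rightarrow> 'v \<Rightarrow> 'v" where "\<And>m. projection_onto scale W (P m)"
    "\<And>x. (\<Sum>m=1..R. ip_adjoint ip (P m) (P m x)) = of_nat R *s x"
proof -
  obtain b where b: "orthonormal_basis scale ip N b" "span (b ` {1..dim W}) = W" "dim W \<le> N"
    using adapted_orthonormal_basis [OF e W(1)] .
  obtain P where P: "\<And>m. projection_onto scale W (P m)"
    and sum: "\<And>x. (\<Sum>m=1..R. ip_adjoint ip (P m) (P m x))
       = (\<Sum>j\<in>{1..N}. (of_real (real R * 1\<^sup>2) * ip x (b j)) *s b j)"
    using projections_with_diagonal_sum [OF b(1) W(2) b(3) R, of "\<lambda>_. 1"] b(2) by auto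
  have "(\<Sum>m=1..R. ip_adjoint ip (P m) (P m x)) = of_nat R *s x" for x
    using arg_cong [OF orthonormal_basis_expansion [OF b(1), of x], of "scale (of_nat R)"]
    by (simp add: sum scale_sum_right del: One_nat_def)
  then show ?thesis using that P by blast
qed

lemma projections_sum_two_eigenvalues:
  assumes e: "orthonormal_basis scale ip N e" and k: "1 \<le> k" and L: "1 \<le> L"
    and M: "M \<le> k" and N: "N = k * L + M"
  obtains P :: "nat \<Rightarrow> 'v \<Rightarrow> 'v" where
    "\<And>m. projection_onto scale (span (e ` {1..k})) (P m)"
    "\<And>j. j \<in> {1..N - M} \<Longrightarrow> eigenvector_of scale
       (\<lambda>x. \<Sum>m=1..L+1. ip_adjoint ip (P m) (P m x)) (of_nat (L + 1)) (e j)"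
    "\<And>j. j \<in> {N - M + 1..N} \<Longrightarrow> eigenvector_of scale
       (\<lambda>x. \<Sum>m=1..L+1. ip_adjoint ip (P m) (P m x)) (of_nat L) (e j)"
proof -
  \<comment> \<open>rescaling the last block, of length \<open>M\<close>, lowers its eigenvalue from \<open>L + 1\<close> to \<open>L\<close>\<close>
  define t where "t j = (if j \<le> k * L then 1 else sqrt (real L / real (L + 1)))" for j
  have kL: "k \<le> k * L" using L by simp
  \<comment> \<open>since \<open>L \<ge> 1\<close>, the rescaled block is not the first one, which the projections must fix\<close>
  have t1: "t j = 1" if "j \<in> {1..k}" for j
  proof -
    have "j \<le> k * L" using that order_trans [OF _ kL] by simp
    then show ?thesis by (simp add: t_def)
  qed
  have kN: "k \<le> N" using kL N by linarith
  have NR: "N \<le> k * (L + 1)" using M N by simp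
  obtain P where P: "\<And>m. projection_onto scale (span (e ` {1..k})) (P m)"
    and sum: "\<And>x. (\<Sum>m=1..L+1. ip_adjoint ip (P m) (P m x))
       = (\<Sum>j\<in>{1..N}. (of_real (real (L + 1) * (t j)\<^sup>2) * ip x (e j)) *s e j)"
    using projections_with_diagonal_sum [OF e k kN NR, of t, OF t1] by blast
  have on: "ip (e i) (e j) = (if i = j then 1 else 0)" if "i \<in> {1..N}" "j \<in> {1..N}" for i j
    using e that by (auto simp: orthonormal_basis_def)
  have eig: "eigenvector_of scale (\<lambda>x. \<Sum>m=1..L+1. ip_adjoint ip (P m) (P m x)) (of_nat r) (e j)"
    if j: "j \<in> {1..N}" and r: "real (L + 1) * (t j)\<^sup>2 = real r" for j r
  proof -
    have "e j \<noteq> 0" using on [OF j j] by auto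
    moreover have "(\<Sum>i\<in>{1..N}. (of_real (real (L + 1) * (t i)\<^sup>2) * ip (e j) (e i)) *s e i)
        = (\<Sum>i\<in>{1..N}. if i = j then of_real (real r) *s e j else 0)"
      unfolding r [symmetric] using j by (intro sum.cong) (auto simp: on)
    ultimately show ?thesis using j unfolding eigenvector_of_def sum by simp
  qed
  have "eigenvector_of scale (\<lambda>x. \<Sum>m=1..L+1. ip_adjoint ip (P m) (P m x)) (of_nat (L + 1)) (e j)"
    if "j \<in> {1..N - M}" for j
    using that N by (intro eig) (auto simp: t_def)
  moreover have "eigenvector_of scale (\<lambda>x. \<Sum>m=1..L+1. ip_adjoint ip (P m) (P m x)) (of_nat L) (e j)"
    if "j \<in> {N - M + 1..N}" for j
    using that N by (intro eig) (auto simp: t_def)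
  ultimately show ?thesis using that P by blast
qed

end

theorem proposition8p2:
  fixes scale :: "'k::rclike \<Rightarrow> 'v::ab_group_add \<Rightarrow> 'v"
    and ip :: "'v \<Rightarrow> 'v \<Rightarrow> 'k"
    and e :: "nat \<Rightarrow> 'v"
    and W :: "'v set"
    and N k :: nat
  assumes "inner_product_space scale ip"
    and "orthonormal_basis scale ip N e"
    and "module.subspace scale W"
    and "vector_space.dim scale W = k"
    and "k \<ge> 1"
  shows
    "(real k \<ge> real N / 2 \<longrightarrow>
        (\<exists>P :: nat \<Rightarrow> 'v \<Rightarrow> 'v.
           (\<forall>i\<in>{1..2}. projection_onto scale W (P i)) \<and>
           (\<forall>x. ip_adjoint ip (P 1) (P 1 x) + ip_adjoint ip (P 2) (P 2 x) = scale 2 x))) \<and>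
     (\<forall>L::nat. L \<ge> 1 \<and> N = k * L \<longrightarrow>
        (\<exists>P :: nat \<Rightarrow> 'v \<Rightarrow> 'v.
           (\<forall>i\<in>{1..L}. projection_onto scale W (P i)) \<and>
           (\<forall>x. (\<Sum>i=1..L. ip_adjoint ip (P i) (P i x)) = scale (of_nat L) x))) \<and>
     (\<forall>L M :: nat. L \<ge> 1 \<and> 1 \<le> M \<and> M < k \<and> N = k * L + M \<longrightarrow>
        (\<exists>(V :: 'v set) (P :: nat \<Rightarrow> 'v \<Rightarrow> 'v).
           module.subspace scale V \<and> vector_space.dim scale V = k \<and>
           (\<forall>i\<in>{1..L+1}. projection_onto scale V (P i)) \<and>
           (\<forall>j\<in>{1..N-M}.
              eigenvector_of scale (\<lambda>x. \<Sum>i=1..L+1. ip_adjoint ip (P i) (P i x)) (of_nat (L + 1)) (e j)) \<and>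
           (\<forall>j\<in>{N-M+1..N}.
              eigenvector_of scale (\<lambda>x. \<Sum>i=1..L+1. ip_adjoint ip (P i) (P i x)) (of_nat L) (e j))))"
proof -
  interpret inner_product_space scale ip by fact
  note e = assms(2) and W = assms(3) and dimW = assms(4) and k = assms(5)
  have W1: "dim W \<ge> 1" using dimW k by simp
  have part1: "\<exists>P :: nat \<Rightarrow> 'v \<Rightarrow> 'v. (\<forall>i\<in>{1..2}. projection_onto scale W (P i)) \<and>
      (\<forall>x. ip_adjoint ip (P 1) (P 1 x) + ip_adjoint ip (P 2) (P 2 x) = scale 2 x)"
    if "real k \<ge> real N / 2"
  proof -
    have "N \<le> dim W * 2" using that dimW by simp
    from projections_sum_scalar [OF e W W1 this] obtain P :: "nat \<Rightarrow> 'v \<Rightarrow> 'v" where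
      "\<And>m. projection_onto scale W (P m)"
      "\<And>x. (\<Sum>m=1..2. ip_adjoint ip (P m) (P m x)) = scale (of_nat 2) x" by blast
    moreover have "{1..2::nat} = {1, 2}" by auto
    ultimately show ?thesis by (intro exI [of _ P]) simp
  qed
  have part2: "\<exists>P :: nat \<Rightarrow> 'v \<Rightarrow> 'v. (\<forall>i\<in>{1..L}. projection_onto scale W (P i)) \<and>
      (\<forall>x. (\<Sum>i=1..L. ip_adjoint ip (P i) (P i x)) = scale (of_nat L) x)"
    if "L \<ge> 1 \<and> N = k * L" for L
  proof -
    have "N \<le> dim W * L" using that dimW by simp
    from projections_sum_scalar [OF e W W1 this] show ?thesis by metis
  qed
  have part3: "\<exists>(V :: 'v set) (P :: nat \<Rightarrow> 'v \<Rightarrow> 'v).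
      subspace V \<and> dim V = k \<and> (\<forall>i\<in>{1..L+1}. projection_onto scale V (P i)) \<and>
      (\<forall>j\<in>{1..N-M}. eigenvector_of scale
         (\<lambda>x. \<Sum>i=1..L+1. ip_adjoint ip (P i) (P i x)) (of_nat (L + 1)) (e j)) \<and>
      (\<forall>j\<in>{N-M+1..N}. eigenvector_of scale
         (\<lambda>x. \<Sum>i=1..L+1. ip_adjoint ip (P i) (P i x)) (of_nat L) (e j))"
    if LM: "L \<ge> 1 \<and> 1 \<le> M \<and> M < k \<and> N = k * L + M" for L M
  proof -
    have "k * 1 \<le> k * L" using LM by (intro mult_le_mono2) simp
    then have "k \<le> N" using LM by linarith
    then have "orthonormal k e" using e by (auto simp: orthonormal_basis_def orthonormal_def)
    then have dim: "dim (span (e ` {1..k})) = k" by (rule dim_span_orthonormal)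
    have "1 \<le> L" "M \<le> k" "N = k * L + M" using LM by auto
    from projections_sum_two_eigenvalues [OF e k this] obtain P :: "nat \<Rightarrow> 'v \<Rightarrow> 'v" where
      "\<And>m. projection_onto scale (span (e ` {1..k})) (P m)"
      "\<And>j. j \<in> {1..N - M} \<Longrightarrow> eigenvector_of scale
         (\<lambda>x. \<Sum>m=1..L+1. ip_adjoint ip (P m) (P m x)) (of_nat (L + 1)) (e j)"
      "\<And>j. j \<in> {N - M + 1..N} \<Longrightarrow> eigenvector_of scale
         (\<lambda>x. \<Sum>m=1..L+1. ip_adjoint ip (P m) (P m x)) (of_nat L) (e j)" by blast
    then show ?thesis
      using dim subspace_span by (intro exI [of _ "span (e ` {1..k})"] exI [of _ P]) blast
  qed
  show ?thesis using part1 part2 part3 by blast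
qed

end
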